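(* Let $\mathbb{X}$ be a finite-dimensional real Banach space of dimension strictly greater than $2$. Then $\mathbb{X}$ is a Euclidean space (i.e. its norm is induced by an inner product) if and only if for every $T\in\mathbb{L}(\mathbb{X})$, either (a) or (b) holds: (a) $M_T=m_T=S_{\mathbb{X}}$. (b) $M_T\perp_B m_T$ and $m_T\perp_B M_T$.
   Context: $S_{\mathbb{X}}$ is the unit sphere of $\mathbb{X}$; $\mathbb{L}(\mathbb{X})$ is the space of bounded linear operators from $\mathbb{X}$ to itself. $M_T=\{x\in S_{\mathbb{X}}:\|Tx\|=\|T\|\}$ and $m_T=\{x\in S_{\mathbb{X}}:\|Tx\|=m(T)\}$, where $m(T)=\inf\{\|Tx\|:\|x\|=1\}$. Birkhoff-James orthogonality: $x\perp_B y$ means $\|x+\lambda y\|\ge\|x\|$ for all scalars $\lambda$; for sets, $A\perp_B B$ means $a\perp_B b$ for all $a\in A$, $b\in B$. A Euclidean space is a finite-dimensional real Hilbert space. *)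

theory Defs
  imports "HOL-Analysis.Analysis"
begin

definition finite_dimensional :: "'a::real_vector itself \<Rightarrow> bool" where
  "finite_dimensional _ \<longleftrightarrow> (\<exists>B::'a set. finite B \<and> span B = UNIV)"

definition is_inner_product :: "('a::real_vector \<Rightarrow> 'a \<Rightarrow> real) \<Rightarrow> bool" where
  "is_inner_product ip \<longleftrightarrow>
     bilinear ip \<and> (\<forall>x y. ip x y = ip y x) \<and> (\<forall>x. x \<noteq> 0 \<longrightarrow> ip x x > 0)"

(* A predicate on a norm, since the type class real_inner cannot be asserted of a type
   inside a formula. *)
definition induced_by_inner_product :: "('a::real_vector \<Rightarrow> real) \<Rightarrow> bool" where
  "induced_by_inner_product N \<longleftrightarrow>
     (\<exists>ip. is_inner_product ip \<and> (\<forall>x. N x = sqrt (ip x x)))"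

definition norm_attainment_set :: "('a::real_normed_vector \<Rightarrow>\<^sub>L 'b::real_normed_vector) \<Rightarrow> 'a set" where
  "norm_attainment_set T = {x \<in> sphere 0 1. norm (blinfun_apply T x) = norm T}"

definition min_norm :: "('a::real_normed_vector \<Rightarrow>\<^sub>L 'b::real_normed_vector) \<Rightarrow> real" where
  "min_norm T = (INF x\<in>sphere 0 1. norm (blinfun_apply T x))"

definition min_norm_attainment_set :: "('a::real_normed_vector \<Rightarrow>\<^sub>L 'b::real_normed_vector) \<Rightarrow> 'a set" where
  "min_norm_attainment_set T = {x \<in> sphere 0 1. norm (blinfun_apply T x) = min_norm T}"

definition bj_orthogonal :: "'a::real_normed_vector \<Rightarrow> 'a \<Rightarrow> bool" where
  "bj_orthogonal x y \<longleftrightarrow> (\<forall>c::real. norm (x + c *\<^sub>R y) \<ge> norm x)"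

definition bj_orthogonal_sets :: "'a::real_normed_vector set \<Rightarrow> 'a set \<Rightarrow> bool" where
  "bj_orthogonal_sets A B \<longleftrightarrow> (\<forall>a\<in>A. \<forall>b\<in>B. bj_orthogonal a b)"

end

theory Submission
  imports Defs
begin

text \<open>Rank-one operators force Birkhoff-James orthogonality to be symmetric. In dimension at least three
  this makes the norm smooth, so \<open>x \<mapsto> ker f\<^sub>x\<close>, with \<open>f\<^sub>x\<close> the support functional at x, is a polarity of
  the projective space. By the fundamental theorem of projective geometry (the real field has no
  nontrivial automorphism) orthogonality is then orthogonality for a definite quadratic form, and the
  norm is constant on the ellipses of that form because rotating along them moves in orthogonal
  directions. Conversely, in a Euclidean space \<open>M\<^sub>T\<close> and \<open>m\<^sub>T\<close> lie in the eigenspaces of \<open>T\<^sup>* T\<close> for its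
  extreme eigenvalues.\<close>

section \<open>Hahn-Banach in finite dimension\<close>

text \<open>An inequality for positive \<open>c\<close> is enough, since applying it to the inverse
  of \<open>c\<close> gives equality. Infima are easier to check in this form.\<close>

definition sublinear :: "('a::real_vector \<Rightarrow> real) \<Rightarrow> bool" where
  "sublinear p \<longleftrightarrow> (\<forall>x y. p (x + y) \<le> p x + p y) \<and> (\<forall>c x. 0 < c \<longrightarrow> p (c *\<^sub>R x) \<le> c * p x)"

lemma sublinear_add: "sublinear p \<Longrightarrow> p (x + y) \<le> p x + p y"
  unfolding sublinear_def by blast

lemma sublinear_scale:
  assumes "sublinear p" "0 < c"
  shows "p (c *\<^sub>R x) = c * p x"
proof (rule antisym)
  show "p (c *\<^sub>R x) \<le> c * p x"
    using assms unfolding sublinear_def by blast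
  have "p (inverse c *\<^sub>R (c *\<^sub>R x)) \<le> inverse c * p (c *\<^sub>R x)"
    using assms unfolding sublinear_def by (meson positive_imp_inverse_positive)
  then show "c * p x \<le> p (c *\<^sub>R x)"
    using \<open>0 < c\<close> by (simp add: field_simps)
qed

lemma sublinear_zero: "sublinear p \<Longrightarrow> p 0 = 0"
  using sublinear_scale[of p 2 0] by simp

lemma sublinear_minus: "sublinear p \<Longrightarrow> - p (- x) \<le> p x"
  using sublinear_add[of p x "- x"] sublinear_zero[of p] by simp

text \<open>Each pair of indices has a third one that serves for the sum, so the bound passes to the
  two infima one after the other.\<close>

lemma sublinear_INF:
  fixes p :: "'i::real_vector \<Rightarrow> 'a::real_vector \<Rightarrow> real"
  assumes ne: "I \<noteq> {}" and bdd: "\<And>z. bdd_below ((\<lambda>t. p t z) ` I)"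
    and add: "\<And>s t z w. s \<in> I \<Longrightarrow> t \<in> I \<Longrightarrow> \<exists>r\<in>I. p r (z + w) \<le> p s z + p t w"
    and scale: "\<And>t c z. t \<in> I \<Longrightarrow> 0 < c \<Longrightarrow> \<exists>r\<in>I. p r (c *\<^sub>R z) \<le> c * p t z"
  shows "sublinear (\<lambda>z. INF t\<in>I. p t z)"
proof -
  let ?q = "\<lambda>z. INF t\<in>I. p t z"
  have lower: "?q z \<le> p t z" if "t \<in> I" for t z
    using bdd that by (rule cINF_lower)
  have "?q (z + w) \<le> ?q z + ?q w" for z w
  proof -
    have "?q (z + w) - p s z \<le> p t w" if "s \<in> I" "t \<in> I" for s t
      using add[OF that, of z w] lower[of _ "z + w"] by fastforce
    then have "?q (z + w) - p s z \<le> ?q w" if "s \<in> I" for s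
      using that by (intro cINF_greatest[OF ne]) auto
    then have "?q (z + w) - ?q w \<le> p s z" if "s \<in> I" for s
      using that by (simp add: diff_le_eq add.commute)
    then have "?q (z + w) - ?q w \<le> ?q z"
      by (intro cINF_greatest[OF ne])
    then show ?thesis by simp
  qed
  moreover have "?q (c *\<^sub>R z) \<le> c * ?q z" if "0 < c" for c z
  proof -
    have "?q (c *\<^sub>R z) / c \<le> p t z" if "t \<in> I" for t
    proof -
      have "?q (c *\<^sub>R z) \<le> c * p t z"
        using scale[OF that \<open>0 < c\<close>, of z] lower order_trans by blast
      then show ?thesis using \<open>0 < c\<close> by (simp add: field_simps)
    qed
    then have "?q (c *\<^sub>R z) / c \<le> ?q z"
      by (intro cINF_greatest[OF ne])
    then show ?thesis using \<open>0 < c\<close> by (simp add: field_simps)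
  qed
  ultimately show ?thesis unfolding sublinear_def by blast
qed

text \<open>The one-vector step of Hahn-Banach: \<open>q z\<close> is the infimum over
  \<open>t \<ge> 0\<close> of \<open>p (z + t *\<^sub>R x) - t * p x\<close>. Together with
  \<open>sublinear_minus\<close>, the last conclusion makes \<open>q\<close> odd at \<open>x\<close>
  with \<open>q x = p x\<close>.\<close>

lemma sublinear_minorant_odd_at:
  assumes p: "sublinear p"
  obtains q where "sublinear q" "\<And>z. q z \<le> p z" "q (- x) \<le> - p x"
proof
  let ?r = "\<lambda>t z. p (z + t *\<^sub>R x) - t * p x"
  let ?q = "\<lambda>z. INF t\<in>{0..}. ?r t z"
  have bdd: "bdd_below ((\<lambda>t. ?r t z) ` {0..})" for z
  proof (rule bdd_belowI2)
    fix t :: real assume "t \<in> {0..}"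
    then have "p (t *\<^sub>R x) = t * p x"
      using sublinear_scale[OF p, of t x] sublinear_zero[OF p] by (cases "t = 0") auto
    moreover have "p (t *\<^sub>R x) \<le> p (z + t *\<^sub>R x) + p (- z)"
      using sublinear_add[OF p, of "z + t *\<^sub>R x" "- z"] by simp
    ultimately show "- p (- z) \<le> ?r t z" by simp
  qed
  show "sublinear ?q"
  proof (rule sublinear_INF[OF _ bdd])
    show "\<exists>r\<in>{0..}. ?r r (z + w) \<le> ?r s z + ?r t w" if "s \<in> {0..}" "t \<in> {0..}" for s t z w
      using that sublinear_add[OF p, of "z + s *\<^sub>R x" "w + t *\<^sub>R x"]
      by (intro bexI[of _ "s + t"]) (auto simp: algebra_simps)
    show "\<exists>r\<in>{0..}. ?r r (c *\<^sub>R z) \<le> c * ?r t z" if "t \<in> {0..}" "0 < c" for t c z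
      using that sublinear_scale[OF p, of c "z + t *\<^sub>R x"]
      by (intro bexI[of _ "c * t"]) (auto simp: algebra_simps)
  qed auto
  show "?q z \<le> p z" for z
    using cINF_lower[OF bdd, of 0 z] by simp
  show "?q (- x) \<le> - p x"
    using cINF_lower[OF bdd, of 1 "- x"] sublinear_zero[OF p] by simp
qed

lemma sublinear_minorant_odd_on:
  assumes "finite B" "sublinear p"
  shows "\<exists>q. sublinear q \<and> (\<forall>z. q z \<le> p z) \<and> (\<forall>b\<in>B. q (- b) \<le> - q b)"
  using assms
proof (induction B arbitrary: p rule: finite_induct)
  case empty
  then show ?case by auto
next
  case (insert b B)
  obtain r where r: "sublinear r" "\<And>z. r z \<le> p z" "r (- b) \<le> - p b"
    using sublinear_minorant_odd_at[OF insert.prems] by blast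
  obtain q where q: "sublinear q" "\<And>z. q z \<le> r z" "\<And>a. a \<in> B \<Longrightarrow> q (- a) \<le> - q a"
    using insert.IH[OF r(1)] by blast
  \<comment> \<open>Oddness at \<open>b\<close> survives in smaller minorants:
    \<open>q (- b) \<le> r (- b) \<le> - p b \<le> - q b\<close>.\<close>
  have "q (- b) \<le> - q b"
    using q(2)[of "- b"] q(2)[of b] r(2)[of b] r(3) by linarith
  then show ?case
    using q r(2) by (intro exI[of _ q]) (auto intro: order_trans)
qed

text \<open>The vectors at which \<open>q\<close> is odd form a subspace, so oddness spreads from
  \<open>B\<close> to the whole space. Subadditivity at the negated vectors is then the reverse
  inequality.\<close>

lemma sublinear_odd_imp_linear:
  assumes q: "sublinear q" and span: "span B = UNIV" and B: "\<And>b. b \<in> B \<Longrightarrow> q (- b) \<le> - q b"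
  shows "linear q"
proof -
  note add = sublinear_add[OF q] and zero = sublinear_zero[OF q] and scale = sublinear_scale[OF q]
  have "subspace {x. q (- x) \<le> - q x}"
  proof (rule subspaceI)
    show "0 \<in> {x. q (- x) \<le> - q x}" using zero by simp
    show "x + y \<in> {x. q (- x) \<le> - q x}"
      if "x \<in> {x. q (- x) \<le> - q x}" "y \<in> {x. q (- x) \<le> - q x}" for x y
      using that add[of x y] add[of "- x" "- y"] by simp
    show "c *\<^sub>R x \<in> {x. q (- x) \<le> - q x}" if "x \<in> {x. q (- x) \<le> - q x}" for c x
    proof -
      consider "c = 0" | "0 < c" | "0 < - c" by linarith
      then show ?thesis
      proof cases
        case 2
        have "c * q (- x) \<le> c * (- q x)"
          using that 2 by (intro mult_left_mono) auto
        then show ?thesis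
          using scale[OF 2, of x] scale[OF 2, of "- x"] by simp
      next
        case 3
        have "(- c) * q (- x) \<le> (- c) * (- q x)"
          using that 3 by (intro mult_left_mono) auto
        then show ?thesis
          using scale[OF 3, of x] scale[OF 3, of "- x"] by simp
      qed (simp add: zero)
    qed
  qed
  then have "span B \<subseteq> {x. q (- x) \<le> - q x}"
    using B by (intro span_minimal) auto
  then have odd: "q (- x) = - q x" for x
    using span sublinear_minus[OF q, of x] by (auto intro!: antisym)
  show ?thesis
  proof (rule linearI)
    show "q (x + y) = q x + q y" for x y
      using add[of x y] add[of "- x" "- y"] odd[of "x + y"] odd[of x] odd[of y] by simp
    show "q (c *\<^sub>R x) = c *\<^sub>R q x" for c x
    proof -
      consider "c = 0" | "0 < c" | "0 < - c" by linarith
      then show ?thesis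
        using scale[of c x] scale[of "- c" x] odd[of "c *\<^sub>R x"] zero by cases auto
    qed
  qed
qed

text \<open>Oddness is arranged at \<open>x\<close> first, which pins the value there for all
  further minorants, and then at the finitely many members of \<open>B\<close>.\<close>

lemma hahn_banach_finite_dim:
  fixes p :: "'a::real_vector \<Rightarrow> real" and B :: "'a set"
  assumes p: "sublinear p" and B: "finite B" "span B = UNIV"
  obtains f where "linear f" "\<And>z. f z \<le> p z" "f x = p x"
proof -
  obtain r where r: "sublinear r" "\<And>z. r z \<le> p z" "r (- x) \<le> - p x"
    using sublinear_minorant_odd_at[OF p] by blast
  obtain f where f: "sublinear f" "\<And>z. f z \<le> r z" "\<And>b. b \<in> B \<Longrightarrow> f (- b) \<le> - f b"
    using sublinear_minorant_odd_on[OF B(1) r(1)] by blast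
  have "linear f"
    using sublinear_odd_imp_linear[OF f(1) B(2) f(3)] .
  moreover have "f z \<le> p z" for z
    using f(2) r(2) by (rule order_trans)
  moreover have "f x = p x"
    using f(2)[of "- x"] r(3) linear_neg[OF \<open>linear f\<close>, of x] calculation(2)[of x] by simp
  ultimately show ?thesis using that by blast
qed

section \<open>Support functionals and Birkhoff-James orthogonality\<close>

text \<open>A norming functional of \<open>x\<close> in the dual unit ball. The bound is one-sided
  because linearity gives the other side at \<open>- z\<close>. At \<open>x = 0\<close> the whole
  dual unit ball qualifies.\<close>

definition support :: "'a::real_normed_vector \<Rightarrow> ('a \<Rightarrow> real) \<Rightarrow> bool" where
  "support x f \<longleftrightarrow> linear f \<and> (\<forall>z. f z \<le> norm z) \<and> f x = norm x"

lemma support_linear: "support x f \<Longrightarrow> linear f"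
  and support_le: "support x f \<Longrightarrow> f z \<le> norm z"
  and support_self: "support x f \<Longrightarrow> f x = norm x"
  unfolding support_def by auto

text \<open>The easy half of James's characterisation: \<open>f\<close> is constant on the line
  through \<open>x\<close> in direction \<open>y\<close> and lies below the norm.\<close>

lemma support_imp_bj_orthogonal:
  assumes f: "support x f" and "f y = 0"
  shows "bj_orthogonal x y"
  unfolding bj_orthogonal_def
proof
  fix c
  have "f (x + c *\<^sub>R y) = norm x"
    using assms support_linear[OF f] support_self[OF f]
    by (simp add: linear_add linear_scale)
  then show "norm x \<le> norm (x + c *\<^sub>R y)"
    using support_le[OF f, of "x + c *\<^sub>R y"] by simp
qed

text \<open>The other half: Hahn-Banach is applied to the distance from the line spanned by
  \<open>y\<close>. Any linear minorant of it kills \<open>y\<close>, and orthogonality says that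
  the distance of \<open>x\<close> is \<open>norm x\<close>.\<close>

lemma bj_orthogonal_imp_support:
  fixes x y :: "'a::real_normed_vector"
  assumes xy: "bj_orthogonal x y" and B: "finite (B::'a set)" "span B = UNIV"
  obtains f where "support x f" "f y = 0"
proof -
  let ?q = "\<lambda>z. INF c\<in>UNIV. norm (z + c *\<^sub>R y)"
  have bdd: "bdd_below ((\<lambda>c. norm (z + c *\<^sub>R y)) ` UNIV)" for z
    by (rule bdd_belowI2[of _ 0]) simp
  have lower: "?q z \<le> norm (z + c *\<^sub>R y)" for z c
    using bdd by (rule cINF_lower) simp
  have "sublinear ?q"
  proof (rule sublinear_INF[OF _ bdd])
    show "\<exists>r\<in>UNIV. norm ((z + w) + r *\<^sub>R y) \<le> norm (z + s *\<^sub>R y) + norm (w + t *\<^sub>R y)" for s t z w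
      using norm_triangle_ineq[of "z + s *\<^sub>R y" "w + t *\<^sub>R y"]
      by (intro bexI[of _ "s + t"]) (auto simp: algebra_simps)
    show "\<exists>r\<in>UNIV. norm (c *\<^sub>R z + r *\<^sub>R y) \<le> c * norm (z + t *\<^sub>R y)" if "0 < c" for t c z
      using that norm_scaleR[of c "z + t *\<^sub>R y"]
      by (intro bexI[of _ "c * t"]) (auto simp: algebra_simps)
  qed simp
  then obtain f where f: "linear f" "\<And>z. f z \<le> ?q z" "f x = ?q x"
    using hahn_banach_finite_dim[OF _ B] by blast
  have "norm x \<le> ?q x"
    using xy unfolding bj_orthogonal_def by (intro cINF_greatest) auto
  moreover have "?q z \<le> norm z" for z
    using lower[of z 0] by simp
  ultimately have "support x f"
    unfolding support_def using f by (auto intro: order_trans antisym)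
  moreover have "f y \<le> 0"
    using f(2)[of y] lower[of y "-1"] by simp
  moreover have "f (- y) \<le> 0"
    using f(2)[of "- y"] lower[of "- y" 1] by simp
  ultimately show ?thesis
    using that linear_neg[OF f(1), of y] by fastforce
qed

lemma support_convex:
  assumes "support x f" "support x g" "0 \<le> a" "0 \<le> b" "a + b = 1"
  shows "support x (\<lambda>z. a * f z + b * g z)"
  unfolding support_def
proof (intro conjI allI)
  show "linear (\<lambda>z. a * f z + b * g z)"
    using assms(1,2) unfolding support_def
    by (intro linearI) (simp_all add: linear_add linear_scale algebra_simps)
  show "a * f z + b * g z \<le> norm z" for z
    using convex_bound_le[of "f z" "norm z" "g z" a b] assms support_le by blast
  have "a * f x + b * g x = (a + b) * norm x"
    using assms(1,2) by (simp add: support_self algebra_simps)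
  then show "a * f x + b * g x = norm x"
    using assms(5) by simp
qed

text \<open>Otherwise the pair of \<open>f\<close> and \<open>g\<close> would embed the space into
  the plane. The assumption on the dimension enters the argument only here.\<close>

lemma dim_gt_2_common_zero:
  fixes f g :: "'a::real_vector \<Rightarrow> real"
  assumes "linear f" "linear g" and dim: "dim (UNIV :: 'a set) > 2"
  obtains k where "k \<noteq> 0" "f k = 0" "g k = 0"
proof (rule ccontr)
  assume neg: "\<not> thesis"
  let ?h = "\<lambda>z. (f z, g z)"
  have lin: "linear ?h"
    using assms(1,2) by (intro linearI) (simp_all add: linear_add linear_scale)
  have inj: "inj ?h"
    using neg that unfolding linear_injective_0[OF lin] by (auto simp: zero_prod_def)
  obtain B :: "'a set" where B: "independent B" "card B = dim (UNIV :: 'a set)"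
    using basis_exists[of "UNIV :: 'a set"] by blast
  have "independent (?h ` B)"
    using linear_independent_injective_image[OF lin B(1)] inj inj_on_subset by blast
  then have "card (?h ` B) \<le> 2"
    using independent_bound by fastforce
  then show False
    using card_image[of ?h B] inj inj_on_subset B(2) dim by fastforce
qed

section \<open>Symmetric orthogonality forces smoothness\<close>

text \<open>If x has two support functionals f and g, every point of the cone \<open>g y < 0 < f y\<close> lies in the
  interior of a segment parallel to x on a sphere, and the directions of all such segments through
  y fill a hyperplane. Hence the norm is linear on the cone, which is impossible because the cone
  contains lines as soon as f and g have a common zero.\<close>

locale bj_symmetric =
  fixes B :: "'a::real_normed_vector set"
  assumes finite_B: "finite B" and span_B: "span B = UNIV"
    and bj_sym: "\<And>x y :: 'a. bj_orthogonal x y \<Longrightarrow> bj_orthogonal y x"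
    and dim_gt_2: "dim (UNIV :: 'a set) > 2"
begin

lemma obtain_support:
  fixes x y :: 'a
  assumes "bj_orthogonal x y"
  obtains f where "support x f" "f y = 0"
  using bj_orthogonal_imp_support[OF assms finite_B span_B] by blast

lemma ex_support:
  fixes x :: 'a
  obtains f where "support x f"
proof -
  have "bj_orthogonal x 0" by (simp add: bj_orthogonal_def)
  then show ?thesis using obtain_support that by blast
qed

text \<open>For each \<open>w\<close> in the cone some convex combination of \<open>f\<close> and
  \<open>g\<close> supports \<open>x\<close> and kills \<open>w\<close>, so by symmetry
  \<open>w\<close> is orthogonal to \<open>x\<close>. Hence every point of a short segment along
  \<open>x\<close> has minimal norm on its line.\<close>

lemma norm_constant_along:
  fixes x y :: 'a
  assumes f: "support x f" and g: "support x g" and y: "0 < f y" "g y < 0"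
  obtains r where "0 < r" "\<And>a. \<bar>a\<bar> \<le> r \<Longrightarrow> norm (y + a *\<^sub>R x) = norm y"
proof (cases "x = 0")
  case True
  then show ?thesis using that[of 1] by simp
next
  case False
  have orth: "bj_orthogonal w x" if w: "0 < f w" "g w < 0" for w
  proof -
    let ?a = "- g w / (f w - g w)" and ?b = "f w / (f w - g w)"
    have "support x (\<lambda>z. ?a * f z + ?b * g z)"
      using f g w by (intro support_convex) (auto simp: divide_simps)
    moreover have "?a * f w + ?b * g w = 0"
      using w by (simp add: divide_simps)
    ultimately show ?thesis
      using support_imp_bj_orthogonal bj_sym by blast
  qed
  \<comment> \<open>Since \<open>f x = g x = norm x\<close>, moving by at most \<open>r\<close>
    along \<open>x\<close> changes \<open>f\<close> and \<open>g\<close> by at most half of their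
    margin, so the point stays in the cone.\<close>
  define r where "r = min (f y) (- g y) / (2 * norm x)"
  have "0 < r" using y False by (simp add: r_def)
  moreover have "norm (y + a *\<^sub>R x) = norm y" if a: "\<bar>a\<bar> \<le> r" for a
  proof (rule antisym)
    have "\<bar>a\<bar> * norm x \<le> r * norm x"
      using a by (intro mult_right_mono) auto
    also have "\<dots> = min (f y) (- g y) / 2"
      using False by (simp add: r_def)
    finally have "\<bar>a * norm x\<bar> \<le> min (f y) (- g y) / 2"
      by (simp add: abs_mult)
    then have "0 < f (y + a *\<^sub>R x)" "g (y + a *\<^sub>R x) < 0"
      using y support_linear[OF f] support_linear[OF g] support_self[OF f] support_self[OF g]
      by (auto simp: linear_add linear_scale)
    then have "norm (y + a *\<^sub>R x) \<le> norm (y + a *\<^sub>R x + (- a) *\<^sub>R x)"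
      using orth unfolding bj_orthogonal_def by blast
    then show "norm (y + a *\<^sub>R x) \<le> norm y" by simp
    show "norm y \<le> norm (y + a *\<^sub>R x)"
      using orth[OF y] unfolding bj_orthogonal_def by blast
  qed
  ultimately show ?thesis using that by blast
qed

text \<open>Tilt \<open>x\<close> slightly to \<open>z = x + d *\<^sub>R h\<close>. Symmetry makes
  \<open>z\<close> orthogonal to every \<open>y + a *\<^sub>R x\<close> on the flat segment. The two
  endpoints give support functionals of \<open>z\<close> with opposite signs at \<open>y\<close>, so
  the norm is flat along \<open>z\<close> as well, and averaging the two flat directions isolates
  \<open>h\<close>.\<close>

lemma norm_flat_direction:
  fixes x y h :: 'a
  assumes x: "x \<noteq> 0" and f: "support x f" and g: "support x g" and y: "0 < f y" "g y < 0"
    and \<phi>: "support y \<phi>" and h: "\<phi> h = 0"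
  obtains e where "0 < e" "norm (y + e *\<^sub>R h) \<le> norm y"
proof -
  note lin\<phi> = support_linear[OF \<phi>]
  obtain r where r: "0 < r" "\<And>a. \<bar>a\<bar> \<le> r \<Longrightarrow> norm (y + a *\<^sub>R x) = norm y"
    using norm_constant_along[OF f g y] by blast
  have "norm y + a * \<phi> x \<le> norm y" if "\<bar>a\<bar> \<le> r" for a
    using support_le[OF \<phi>, of "y + a *\<^sub>R x"] r(2)[OF that] support_self[OF \<phi>]
    by (simp add: linear_add[OF lin\<phi>] linear_scale[OF lin\<phi>])
  from this[of r] this[of "- r"] have \<phi>x: "\<phi> x = 0"
    using r(1) by (simp add: mult_le_0_iff zero_le_mult_iff)
  \<comment> \<open>Small enough that every support functional of \<open>z\<close> stays positive at
    \<open>x\<close>; the summand 1 covers \<open>h = 0\<close>.\<close>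
  define d where "d = norm x / (2 * norm h + 1)"
  have "0 < d" using x by (simp add: d_def add_nonneg_pos)
  define z where "z = x + d *\<^sub>R h"
  have \<phi>z: "\<phi> z = 0"
    by (simp add: z_def linear_add[OF lin\<phi>] linear_scale[OF lin\<phi>] \<phi>x h)
  have dh: "2 * (d * norm h) < norm x"
    using x by (simp add: d_def divide_simps add_nonneg_pos)
  have pos: "0 < \<psi> x" if \<psi>: "support z \<psi>" for \<psi>
  proof -
    have "\<psi> x = norm z - d * \<psi> h"
      using support_self[OF \<psi>] by (simp add: z_def linear_add linear_scale support_linear[OF \<psi>])
    moreover have "d * \<psi> h \<le> d * norm h"
      using support_le[OF \<psi>] \<open>0 < d\<close> by (intro mult_left_mono) auto
    moreover have "norm x \<le> norm z + d * norm h"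
      using norm_triangle_ineq4[of z "d *\<^sub>R h"] \<open>0 < d\<close> by (simp add: z_def)
    ultimately show ?thesis using dh by linarith
  qed
  have ex: "\<exists>\<psi>. support z \<psi> \<and> \<psi> y = - a * \<psi> x" if a: "\<bar>a\<bar> \<le> r" for a
  proof -
    have "support (y + a *\<^sub>R x) \<phi>"
      using \<phi> r(2)[OF a] \<phi>x unfolding support_def by (simp add: linear_add linear_scale)
    then have "bj_orthogonal z (y + a *\<^sub>R x)"
      using support_imp_bj_orthogonal \<phi>z bj_sym by blast
    then obtain \<psi> where \<psi>: "support z \<psi>" "\<psi> (y + a *\<^sub>R x) = 0"
      using obtain_support by blast
    then have "\<psi> y = - a * \<psi> x"
      using support_linear[OF \<psi>(1)] by (simp add: linear_add linear_scale)
    with \<psi>(1) show ?thesis by blast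
  qed
  obtain \<psi> where \<psi>: "support z \<psi>" "\<psi> y = - (- r) * \<psi> x"
    using ex[of "- r"] r(1) by auto
  obtain \<psi>' where \<psi>': "support z \<psi>'" "\<psi>' y = - r * \<psi>' x"
    using ex[of r] r(1) by auto
  have "0 < \<psi> y" "\<psi>' y < 0"
    using \<psi>(2) \<psi>'(2) pos[OF \<psi>(1)] pos[OF \<psi>'(1)] r(1) by (auto simp: mult_less_0_iff)
  then obtain s where s: "0 < s" "\<And>a. \<bar>a\<bar> \<le> s \<Longrightarrow> norm (y + a *\<^sub>R z) = norm y"
    using norm_constant_along[OF \<psi>(1) \<psi>'(1)] by blast
  define t where "t = min r s"
  have t: "0 < t" "t \<le> r" "t \<le> s" using r(1) s(1) by (auto simp: t_def)
  \<comment> \<open>The terms in \<open>x\<close> cancel in the midpoint of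
    \<open>y + t *\<^sub>R z\<close> and \<open>y - t *\<^sub>R x\<close>, two points of norm
    \<open>norm y\<close>.\<close>
  have "2 *\<^sub>R (y + (t * d / 2) *\<^sub>R h) = (y + t *\<^sub>R z) + (y + (- t) *\<^sub>R x)"
    by (simp add: z_def algebra_simps scaleR_2)
  then have "2 * norm (y + (t * d / 2) *\<^sub>R h) = norm ((y + t *\<^sub>R z) + (y + (- t) *\<^sub>R x))"
    by (metis norm_scaleR abs_numeral)
  also have "\<dots> \<le> norm (y + t *\<^sub>R z) + norm (y + (- t) *\<^sub>R x)"
    by (rule norm_triangle_ineq)
  also have "\<dots> = 2 * norm y"
    using s(2)[of t] r(2)[of "- t"] t by simp
  finally show ?thesis
    using that[of "t * d / 2"] t(1) \<open>0 < d\<close> by simp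
qed

text \<open>Continuation along a ray that stays in the cone: the parameters at which
  \<open>\<phi>\<close> still supports form a closed interval from 0 by convexity, and
  \<open>norm_flat_direction\<close> extends it beyond each of its points.\<close>

lemma support_constant_along:
  fixes x y k :: 'a
  assumes x: "x \<noteq> 0" and f: "support x f" and g: "support x g" and y: "0 < f y" "g y < 0"
    and \<phi>: "support y \<phi>" and k: "f k = 0" "g k = 0" and "0 \<le> t"
  shows "support (y + t *\<^sub>R k) \<phi>"
proof -
  note lin\<phi> = support_linear[OF \<phi>]
  define S where "S = {t. 0 \<le> t \<and> norm (y + t *\<^sub>R k) - \<phi> (y + t *\<^sub>R k) \<le> 0}"
  have \<phi>_at: "\<phi> (y + t *\<^sub>R k) = norm y + t * \<phi> k" for t
    using support_self[OF \<phi>] by (simp add: linear_add[OF lin\<phi>] linear_scale[OF lin\<phi>])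
  have S_iff: "t \<in> S \<longleftrightarrow> 0 \<le> t \<and> norm (y + t *\<^sub>R k) \<le> norm y + t * \<phi> k" for t
    by (simp add: S_def \<phi>_at)
  have S_supp: "support (y + t *\<^sub>R k) \<phi>" if "t \<in> S" for t
    using that \<phi> support_le[OF \<phi>, of "y + t *\<^sub>R k"] unfolding S_iff support_def
    by (auto simp: \<phi>_at)
  have "0 \<in> S" by (simp add: S_iff)
  have down: "s \<in> S" if "t \<in> S" "0 \<le> s" "s \<le> t" for s t
  proof (cases "t = 0")
    case False
    define a where "a = s / t"
    have a: "0 \<le> a" "a \<le> 1" "s = a * t"
      using that False by (auto simp: a_def divide_simps)
    have "y + s *\<^sub>R k = (1 - a) *\<^sub>R y + a *\<^sub>R (y + t *\<^sub>R k)"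
      by (simp add: a(3) algebra_simps)
    then have "norm (y + s *\<^sub>R k) \<le> (1 - a) * norm y + a * norm (y + t *\<^sub>R k)"
      using norm_triangle_ineq[of "(1 - a) *\<^sub>R y" "a *\<^sub>R (y + t *\<^sub>R k)"] a by simp
    also have "\<dots> \<le> (1 - a) * norm y + a * (norm y + t * \<phi> k)"
      using that a by (intro add_mono mult_left_mono) (auto simp: S_iff)
    also have "\<dots> = norm y + s * \<phi> k"
      by (simp add: a(3) algebra_simps)
    finally show ?thesis using that by (simp add: S_iff)
  qed (use that in auto)
  have step: "\<exists>s>t. s \<in> S" if "t \<in> S" for t
  proof -
    define u where "u = y + t *\<^sub>R k"
    have u: "0 < f u" "g u < 0"
      using y k support_linear[OF f] support_linear[OF g]
      by (auto simp: u_def linear_add linear_scale)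
    have \<phi>u: "support u \<phi>"
      using S_supp[OF that] by (simp add: u_def)
    have "u \<noteq> 0" using u linear_0[OF support_linear[OF f]] by auto
    then have u0: "0 < norm u" by simp
    \<comment> \<open>Splits \<open>k = c *\<^sub>R u + h\<close> with \<open>h\<close> in the
      kernel of \<open>\<phi>\<close>, so a step along \<open>k\<close> is a step along
      \<open>h\<close> followed by a rescaling.\<close>
    define c where "c = \<phi> k / norm u"
    define h where "h = k - c *\<^sub>R u"
    have "\<phi> h = 0"
      using u0 support_self[OF \<phi>u] by (simp add: h_def c_def linear_diff[OF lin\<phi>] linear_scale[OF lin\<phi>])
    then obtain e where e: "0 < e" "norm (u + e *\<^sub>R h) \<le> norm u"
      using norm_flat_direction[OF x f g u \<phi>u] by blast
    \<comment> \<open>Shrinks \<open>e\<close> so that \<open>1 - e' * c\<close> is positive;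
      convexity keeps the norm bound at the shorter step \<open>e'\<close>.\<close>
    define a where "a = min 1 (1 / (2 * e * (\<bar>c\<bar> + 1)))"
    define e' where "e' = a * e"
    have a: "0 < a" "a \<le> 1" using e(1) by (auto simp: a_def intro!: divide_pos_pos mult_pos_pos)
    have e': "0 < e'" using a e(1) by (simp add: e'_def)
    have "a * (2 * e * (\<bar>c\<bar> + 1)) \<le> 1"
      using e(1) by (subst pos_le_divide_eq[symmetric]) (auto simp: a_def)
    then have "e' * \<bar>c\<bar> \<le> 1 / 2"
      using e' by (simp add: e'_def algebra_simps)
    moreover have "e' * c \<le> e' * \<bar>c\<bar>"
      using e' by (intro mult_left_mono) auto
    ultimately have ec: "0 < 1 - e' * c" by linarith
    have "u + e' *\<^sub>R h = (1 - a) *\<^sub>R u + a *\<^sub>R (u + e *\<^sub>R h)"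
      by (simp add: e'_def algebra_simps)
    then have "norm (u + e' *\<^sub>R h) \<le> (1 - a) * norm u + a * norm (u + e *\<^sub>R h)"
      using norm_triangle_ineq[of "(1 - a) *\<^sub>R u" "a *\<^sub>R (u + e *\<^sub>R h)"] a by simp
    also have "\<dots> \<le> (1 - a) * norm u + a * norm u"
      using a e(2) by (intro add_mono mult_left_mono) auto
    also have "\<dots> = norm u" by (simp add: algebra_simps)
    finally have le: "norm (u + e' *\<^sub>R h) \<le> norm u" .
    \<comment> \<open>The solution of \<open>(1 + s * c) * e' = s\<close>, which turns
      \<open>(1 + s * c) *\<^sub>R (u + e' *\<^sub>R h)\<close> into
      \<open>u + s *\<^sub>R k\<close>.\<close>
    define s where "s = e' / (1 - e' * c)"
    have "0 < s" using e' ec by (simp add: s_def)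
    have sc: "(1 + s * c) * e' = s" "(1 - e' * c) * (1 + s * c) = 1"
      using ec by (auto simp: s_def field_simps)
    have sc0: "0 < 1 + s * c"
      using sc(2) ec by (metis zero_less_mult_pos zero_less_one)
    have "(1 + s * c) *\<^sub>R (u + e' *\<^sub>R h) = (1 + s * c) *\<^sub>R u + ((1 + s * c) * e') *\<^sub>R h"
      by (simp add: scaleR_add_right)
    also have "\<dots> = u + s *\<^sub>R k"
      unfolding sc(1) by (simp add: h_def algebra_simps)
    also have "\<dots> = y + (t + s) *\<^sub>R k"
      by (simp add: u_def algebra_simps)
    finally have "norm (y + (t + s) *\<^sub>R k) = (1 + s * c) * norm (u + e' *\<^sub>R h)"
      using sc0 by (metis norm_scaleR abs_of_pos)
    also have "\<dots> \<le> (1 + s * c) * norm u"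
      using le sc0 by (intro mult_left_mono) auto
    also have "\<dots> = norm y + (t + s) * \<phi> k"
      using support_self[OF \<phi>u] u0 \<phi>_at[of t] by (simp add: c_def u_def algebra_simps)
    finally have "t + s \<in> S"
      using that \<open>0 < s\<close> by (simp add: S_iff)
    with \<open>0 < s\<close> show ?thesis by (intro exI[of _ "t + s"]) simp
  qed
  have "closed S"
    unfolding S_def \<phi>_at by (intro closed_Collect_conj closed_Collect_le continuous_intros)
  have "\<not> bdd_above S"
  proof
    assume bdd: "bdd_above S"
    then have "Sup S \<in> S"
      using \<open>closed S\<close> \<open>0 \<in> S\<close> closed_contains_Sup by blast
    then obtain s where "s > Sup S" "s \<in> S" using step by blast
    then show False using cSup_upper[OF _ bdd] by fastforce
  qed
  then obtain s where "s \<in> S" "t \<le> s"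
    unfolding bdd_above_def by (meson linear)
  then show ?thesis
    using down \<open>0 \<le> t\<close> S_supp by blast
qed

text \<open>A common zero \<open>k\<close> of \<open>f\<close> and \<open>g\<close> spans a
  direction whose lines stay in the cone. One functional \<open>\<phi>\<close> would support a whole
  such line, making the norm affine on it, although the norm grows at both ends.\<close>

lemma support_unique:
  fixes x :: 'a
  assumes x: "x \<noteq> 0" and f: "support x f" and g: "support x g"
  shows "f = g"
proof (rule ccontr)
  assume "f \<noteq> g"
  note linf = support_linear[OF f] and ling = support_linear[OF g]
  from \<open>f \<noteq> g\<close> obtain v0 where "f v0 \<noteq> g v0" by blast
  then obtain v where v: "g v < f v"
    using linear_neg[OF linf, of v0] linear_neg[OF ling, of v0]
    by (cases "g v0 < f v0") (auto intro: that[of v0] that[of "- v0"])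
  \<comment> \<open>Subtracting a multiple of \<open>x\<close> shifts \<open>f\<close> and
    \<open>g\<close> equally; this multiple makes their values opposite.\<close>
  define y where "y = v - ((f v + g v) / (2 * norm x)) *\<^sub>R x"
  have "f y = (f v - g v) / 2" "g y = (g v - f v) / 2"
    using x support_self[OF f] support_self[OF g]
    by (simp_all add: y_def linear_diff[OF linf] linear_scale[OF linf]
        linear_diff[OF ling] linear_scale[OF ling] field_simps)
  with v have y: "0 < f y" "g y < 0" by auto
  obtain k where k: "k \<noteq> 0" "f k = 0" "g k = 0"
    using dim_gt_2_common_zero[OF linf ling dim_gt_2] by blast
  obtain \<phi> where \<phi>: "support y \<phi>" using ex_support by blast
  note lin\<phi> = support_linear[OF \<phi>]
  \<comment> \<open>Adding the bounds at \<open>y + n *\<^sub>R k\<close> and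
    \<open>y - n *\<^sub>R k\<close> cancels \<open>\<phi> k\<close> and leaves
    \<open>n * norm k \<le> 2 * norm y\<close>, which this \<open>n\<close> violates.\<close>
  define n where "n = (2 * norm y + 1) / norm k"
  have n: "0 \<le> n" "n * norm k = 2 * norm y + 1" using k by (auto simp: n_def)
  have "n * norm k \<le> norm y + norm (y + n *\<^sub>R l)" if "norm l = norm k" for l
    using norm_triangle_ineq4[of "y + n *\<^sub>R l" y] that n(1) by simp
  moreover have "norm (y + n *\<^sub>R k) = norm y + n * \<phi> k"
    using support_self[OF support_constant_along[OF x f g y \<phi> k(2,3) n(1)]] support_self[OF \<phi>]
    by (simp add: linear_add[OF lin\<phi>] linear_scale[OF lin\<phi>])
  moreover have "norm (y + n *\<^sub>R (- k)) = norm y - n * \<phi> k"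
    using support_self[OF support_constant_along[OF x f g y \<phi> _ _ n(1), of "- k"]]
      support_self[OF \<phi>] k linear_neg[OF linf, of k] linear_neg[OF ling, of k]
    by (simp add: linear_diff[OF lin\<phi>] linear_scale[OF lin\<phi>])
  ultimately have "n * norm k \<le> 2 * norm y + n * \<phi> k" "n * norm k \<le> 2 * norm y - n * \<phi> k"
    by (metis add.assoc mult_2, metis add_diff_eq norm_minus_cancel mult_2)
  then show False using n(2) by linarith
qed

text \<open>The semi-inner product of the norm. By \<open>support_unique\<close> the choice is
  forced for nonzero \<open>x\<close>, and the factor \<open>norm x\<close> removes it at 0 and
  makes \<open>G\<close> homogeneous in \<open>x\<close>. Its zeros are exactly the orthogonal
  pairs; linearity in \<open>x\<close> is what remains to be shown.\<close>

definition G :: "'a \<Rightarrow> 'a \<Rightarrow> real" where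
  "G x y = norm x * (SOME f. support x f) y"

lemma G_eq: "support x f \<Longrightarrow> G x y = norm x * f y"
proof (cases "x = 0")
  case False
  assume f: "support x f"
  then have "support x (SOME f. support x f)" using someI[of "support x" f] by simp
  then show ?thesis using support_unique[OF False f] by (simp add: G_def)
qed (simp add: G_def)

lemma G_linear: "linear (G x)"
proof -
  obtain f where f: "support x f" using ex_support by blast
  then show ?thesis
    using support_linear[OF f] unfolding G_eq[OF f, abs_def]
    by (intro linearI) (simp_all add: linear_add linear_scale algebra_simps)
qed

lemma G_self: "G x x = (norm x)\<^sup>2"
proof -
  obtain f where f: "support x f" using ex_support by blast
  then show ?thesis using support_self[OF f] by (simp add: G_eq[OF f] power2_eq_square)
qed

lemma G_scale: "G (c *\<^sub>R x) y = c * G x y"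
proof (cases "c = 0")
  case False
  obtain f where f: "support x f" using ex_support by blast
  note linf = support_linear[OF f]
  have "support (c *\<^sub>R x) (\<lambda>z. sgn c * f z)"
    unfolding support_def
  proof (intro conjI allI)
    show "linear (\<lambda>z. sgn c * f z)"
      by (intro linearI) (simp_all add: linear_add[OF linf] linear_scale[OF linf] algebra_simps)
    show "sgn c * f z \<le> norm z" for z
      using support_le[OF f, of "sgn c *\<^sub>R z"] False
      by (simp add: linear_scale[OF linf] sgn_real_def split: if_splits)
    show "sgn c * f (c *\<^sub>R x) = norm (c *\<^sub>R x)"
      using support_self[OF f] by (simp add: linear_scale[OF linf] sgn_real_def)
  qed
  then show ?thesis
    using f by (simp add: G_eq sgn_real_def)
qed (simp add: G_def)

lemma G_eq_0_imp_bj: "G x y = 0 \<Longrightarrow> bj_orthogonal x y"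
proof (cases "x = 0")
  case False
  assume "G x y = 0"
  obtain f where f: "support x f" using ex_support by blast
  then show ?thesis
    using \<open>G x y = 0\<close> False support_imp_bj_orthogonal[OF f] by (simp add: G_eq)
qed (simp add: bj_orthogonal_def)

lemma bj_imp_G_eq_0:
  assumes "bj_orthogonal x y"
  shows "G x y = 0"
proof -
  obtain f where "support x f" "f y = 0"
    using obtain_support[OF assms] by blast
  then show ?thesis by (simp add: G_eq)
qed

end

section \<open>Real polarities of dimension greater than two\<close>

text \<open>Nonnegative numbers are squares, so \<open>m\<close> is monotone, and it fixes the
  integers. Comparing \<open>real n * t\<close> with its floor bounds
  \<open>real n * (m t - t)\<close> by 1 in absolute value for all \<open>n\<close>.\<close>

lemma additive_multiplicative_imp_id:
  fixes m :: "real \<Rightarrow> real"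
  assumes add: "\<And>s t. m (s + t) = m s + m t" and mult: "\<And>s t. m (s * t) = m s * m t"
    and one: "m 1 = 1"
  shows "m t = t"
proof -
  have zero: "m 0 = 0" using add[of 0 0] by simp
  have minus: "m (- t) = - m t" for t using add[of t "- t"] zero by simp
  have nonneg: "0 \<le> m t" if "0 \<le> t" for t
    using mult[of "sqrt t" "sqrt t"] that by simp
  have mono: "m s \<le> m t" if "s \<le> t" for s t
    using nonneg[of "t - s"] add[of s "t - s"] that by simp
  have nat: "m (real n) = real n" for n
    by (induction n) (simp_all add: zero one add)
  have int: "m (of_int k) = of_int k" for k
    using nat minus by (cases k rule: int_cases2) auto
  have close: "\<bar>real n * (m t - t)\<bar> \<le> 1" for n
  proof -
    have "of_int \<lfloor>real n * t\<rfloor> \<le> m (real n * t)" "m (real n * t) \<le> of_int (\<lfloor>real n * t\<rfloor> + 1)"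
      using mono[of "of_int \<lfloor>real n * t\<rfloor>" "real n * t"]
        mono[of "real n * t" "of_int (\<lfloor>real n * t\<rfloor> + 1)"] unfolding int by linarith+
    then show ?thesis
      unfolding mult nat right_diff_distrib by linarith
  qed
  show ?thesis
  proof (rule ccontr)
    assume "m t \<noteq> t"
    then obtain n where "1 < real n * \<bar>m t - t\<bar>"
      using reals_Archimedean3[of "\<bar>m t - t\<bar>"] by auto
    then show False using close[of n] by (simp add: abs_mult)
  qed
qed

text \<open>G sends a point to a functional, hence to a hyperplane. Von Staudt's coordinate argument shows
  that each of the ratios A and C below is, up to a constant factor, a field automorphism of the reals.\<close>

locale polarity =
  fixes G :: "'a::real_vector \<Rightarrow> 'a \<Rightarrow> real"
  assumes lin: "linear (G x)" and scale: "G (c *\<^sub>R x) y = c * G x y"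
    and pos: "x \<noteq> 0 \<Longrightarrow> 0 < G x x" and sym0: "G x y = 0 \<Longrightarrow> G y x = 0"
begin

lemmas lin_simps = linear_add[OF lin] linear_diff[OF lin] linear_scale[OF lin] linear_0[OF lin]

lemma eq_0_sym: "G x y = 0 \<longleftrightarrow> G y x = 0"
  using sym0 by blast

text \<open>Linearity of the second argument, carried to the first by the symmetry of vanishing.
  This is the only substitute for additivity in the first argument.\<close>

lemma eq_0_combination:
  assumes "G u d = 0" "G v d = 0"
  shows "G (a *\<^sub>R u + b *\<^sub>R v) d = 0"
  using assms[THEN sym0] by (intro sym0[of d]) (simp add: lin_simps)

text \<open>For a symmetric bilinear form the constant would be \<open>G e2 e2 / G e1 e1\<close>.
  The third vector \<open>e3\<close> gives room to recover this relation from the zeros of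
  \<open>G\<close> alone.\<close>

lemma coordinate_ratio:
  assumes e: "e1 \<noteq> 0" "e2 \<noteq> 0" "e3 \<noteq> 0" and orth: "G e1 e2 = 0" "G e1 e3 = 0" "G e2 e3 = 0"
  obtains c where "0 < c" "\<And>t. G (e1 + t *\<^sub>R e2) e2 = c * t * G (e1 + t *\<^sub>R e2) e1"
proof -
  note orth' = orth orth[THEN sym0]
  note p = e[THEN pos]
  have nz: "G (e1 + b *\<^sub>R e2 + c *\<^sub>R e3) e1 \<noteq> 0" for b c
    using p by (subst eq_0_sym) (simp add: lin_simps orth')
  have nz2: "G (e1 + b *\<^sub>R e2) e1 \<noteq> 0" for b
    using nz[of b 0] by simp
  have nz3: "G (e1 + c *\<^sub>R e3) e1 \<noteq> 0" for c
    using nz[of 0 c] by simp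
  define A where "A t = G (e1 + t *\<^sub>R e2) e2 / G (e1 + t *\<^sub>R e2) e1" for t
  define C where "C t = G (e1 + t *\<^sub>R e3) e3 / G (e1 + t *\<^sub>R e3) e1" for t
  have zA: "G (e1 + t *\<^sub>R e2 + s *\<^sub>R e3) e2 = A t * G (e1 + t *\<^sub>R e2 + s *\<^sub>R e3) e1" for t s
  proof -
    \<comment> \<open>Killed by both \<open>e1 + t *\<^sub>R e2\<close> and \<open>e3\<close>, so
      adding a multiple of \<open>e3\<close> does not change the ratio.\<close>
    let ?d = "A t *\<^sub>R e1 - e2"
    have "G (1 *\<^sub>R (e1 + t *\<^sub>R e2) + s *\<^sub>R e3) ?d = 0"
      by (rule eq_0_combination) (simp_all add: lin_simps orth' A_def nz2)
    then show ?thesis by (simp add: lin_simps)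
  qed
  have zC: "G (e1 + t *\<^sub>R e2 + s *\<^sub>R e3) e3 = C s * G (e1 + t *\<^sub>R e2 + s *\<^sub>R e3) e1" for t s
  proof -
    let ?d = "C s *\<^sub>R e1 - e3"
    have "G (1 *\<^sub>R (e1 + s *\<^sub>R e3) + t *\<^sub>R e2) ?d = 0"
      by (rule eq_0_combination) (simp_all add: lin_simps orth' C_def nz3)
    then show ?thesis by (simp add: lin_simps add_ac)
  qed
  \<comment> \<open>Both \<open>e1 + t *\<^sub>R e2 + s *\<^sub>R e3\<close> and \<open>e1\<close>
    kill \<open>?d\<close>, hence so does their difference.\<close>
  have AC: "C s * G (t *\<^sub>R e2 + s *\<^sub>R e3) e2 = A t * G (t *\<^sub>R e2 + s *\<^sub>R e3) e3" for t s
  proof -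
    let ?d = "C s *\<^sub>R e2 - A t *\<^sub>R e3"
    have "G (1 *\<^sub>R (e1 + t *\<^sub>R e2 + s *\<^sub>R e3) + (- 1) *\<^sub>R e1) ?d = 0"
      by (rule eq_0_combination) (simp_all add: lin_simps orth' zA zC)
    then show ?thesis by (simp add: lin_simps)
  qed
  have A0: "A t = 0 \<longleftrightarrow> t = 0" for t
  proof -
    have "G (e1 + t *\<^sub>R e2) e2 = 0 \<longleftrightarrow> t = 0"
      using p by (subst eq_0_sym) (simp add: lin_simps orth')
    then show ?thesis using nz2 by (simp add: A_def)
  qed
  have C0: "C t = 0 \<longleftrightarrow> t = 0" for t
  proof -
    have "G (e1 + t *\<^sub>R e3) e3 = 0 \<longleftrightarrow> t = 0"
      using p by (subst eq_0_sym) (simp add: lin_simps orth')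
    then show ?thesis using nz3 by (simp add: C_def)
  qed
  \<comment> \<open>The points \<open>u\<close> and \<open>t *\<^sub>R u\<close> define the same
    hyperplane; comparing \<open>AC\<close> at both yields multiplicativity.\<close>
  have CA: "C (t * s) * A 1 = A t * C s" for t s
  proof (cases "t = 0")
    case True
    then show ?thesis using A0[of 0] C0[of 0] by simp
  next
    case False
    define u where "u = e2 + s *\<^sub>R e3"
    have u: "G u e2 \<noteq> 0"
      using p unfolding u_def by (subst eq_0_sym) (simp add: lin_simps orth')
    have "C s * G u e2 = A 1 * G u e3"
      using AC[of s 1] by (simp add: u_def)
    moreover have "C (t * s) * G (t *\<^sub>R u) e2 = A t * G (t *\<^sub>R u) e3"
      using AC[of "t * s" t] by (simp add: u_def scaleR_add_right)
    then have "C (t * s) * G u e2 = A t * G u e3"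
      using False by (simp add: scale)
    ultimately have "(C (t * s) * A 1) * G u e2 = (A t * C s) * G u e2"
      by (simp add: algebra_simps)
    then show ?thesis using u by simp
  qed
  have A1: "A 1 \<noteq> 0" and C1: "C 1 \<noteq> 0" using A0[of 1] C0[of 1] by auto
  define m where "m t = A t / A 1" for t
  have m_C: "m t = C t / C 1" for t
    using CA[of t 1] A1 C1 by (simp add: m_def divide_simps)
  have m_id: "m t = t" for t
  proof (rule additive_multiplicative_imp_id)
    show "m 1 = 1" using A1 by (simp add: m_def)
    show "m (s * t) = m s * m t" for s t
    proof -
      have "m (s * t) = C (s * t) * A 1 / (A 1 * C 1)"
        using A1 by (simp add: m_C)
      also have "\<dots> = m s * (C t / C 1)"
        unfolding CA by (simp add: m_def)
      finally show ?thesis by (simp add: m_C)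
    qed
    show "m (t + r) = m t + m r" for t r
    proof -
      \<comment> \<open>Chosen to be killed by both \<open>e1 + t *\<^sub>R e2\<close> and
        \<open>e2 + e3\<close>. The point \<open>?z\<close> is a combination of these, and its
        coordinates bring in \<open>m (t + r)\<close> and \<open>m r\<close>.\<close>
      let ?d = "(1 / A 1) *\<^sub>R e2 - (1 / C 1) *\<^sub>R e3 - m t *\<^sub>R e1"
      let ?z = "e1 + (t + r) *\<^sub>R e2 + r *\<^sub>R e3"
      have "G (e1 + t *\<^sub>R e2) e3 = 0"
        by (subst eq_0_sym) (simp add: lin_simps orth')
      moreover have "G (e1 + t *\<^sub>R e2) e2 = A t * G (e1 + t *\<^sub>R e2) e1"
        using zA[of t 0] by simp
      ultimately have 1: "G (e1 + t *\<^sub>R e2) ?d = 0"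
        by (simp add: lin_simps m_def)
      have "G (e2 + e3) e1 = 0"
        by (subst eq_0_sym) (simp add: lin_simps orth')
      moreover have "C 1 * G (e2 + e3) e2 = A 1 * G (e2 + e3) e3"
        using AC[of 1 1] by simp
      ultimately have 2: "G (e2 + e3) ?d = 0"
        using A1 C1 by (simp add: lin_simps field_simps)
      have "G (1 *\<^sub>R (e1 + t *\<^sub>R e2) + r *\<^sub>R (e2 + e3)) ?d = 0"
        using 1 2 by (rule eq_0_combination)
      also have "1 *\<^sub>R (e1 + t *\<^sub>R e2) + r *\<^sub>R (e2 + e3) = ?z"
        by (simp add: algebra_simps)
      finally have "(m (t + r) - m r - m t) * G ?z e1 = 0"
        unfolding lin_simps zA zC m_def[of "t + r"] m_C[of r] by (simp add: algebra_simps)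
      then show ?thesis using nz by simp
    qed
  qed
  have A: "A t = A 1 * t" for t
    using A1 m_id[of t] unfolding m_def by (simp add: divide_eq_eq mult.commute)
  have rel: "G (e1 + t *\<^sub>R e2) e2 = A 1 * t * G (e1 + t *\<^sub>R e2) e1" for t
    using zA[of t 0] A[of t] by simp
  have "0 < A 1"
  proof (rule ccontr)
    assume "\<not> 0 < A 1"
    then have neg: "A 1 < 0" using A1 by simp
    \<comment> \<open>A negative \<open>A 1\<close> would make \<open>e1 + t *\<^sub>R e2\<close>
      isotropic for this \<open>t\<close>, against definiteness.\<close>
    define t where "t = 1 / sqrt (- A 1)"
    have "t * t = - (1 / A 1)"
      using neg by (simp add: t_def)
    then have t: "A 1 * t * t = - 1"
      using neg by (simp add: mult.assoc)
    let ?z = "e1 + t *\<^sub>R e2"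
    have "G ?z ?z = G ?z e1 * (1 + A 1 * t * t)"
      by (simp add: lin_simps(1,3) rel algebra_simps)
    then have "G ?z ?z = 0" using t by simp
    then have "?z = 0" using pos by force
    then show False using nz2[of t] scale[of 0 0 e1] by simp
  qed
  then show ?thesis using rel that by blast
qed

end

section \<open>The support functionals form an inner product\<close>

lemma bj_orthogonal_norm_le:
  assumes "bj_orthogonal x y"
  shows "\<bar>a\<bar> * norm x \<le> norm (a *\<^sub>R x + b *\<^sub>R y)"
proof (cases "a = 0")
  case False
  have "norm x \<le> norm (x + (b / a) *\<^sub>R y)"
    using assms unfolding bj_orthogonal_def by blast
  then have "\<bar>a\<bar> * norm x \<le> \<bar>a\<bar> * norm (x + (b / a) *\<^sub>R y)"
    by (intro mult_left_mono) auto
  also have "\<dots> = norm (a *\<^sub>R x + b *\<^sub>R y)"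
    using False by (simp flip: norm_scaleR add: scaleR_add_right)
  finally show ?thesis .
qed simp

text \<open>Split \<open>d\<close> into \<open>n\<close> equal steps. By Bernoulli's inequality the
  product of the cosines is at least \<open>1 - d\<^sup>2 / (2 * n)\<close> for large
  \<open>n\<close>, which tends to 1. As \<open>d\<close> may have either sign, both inequalities
  follow.\<close>

lemma cos_lower_bound_imp_constant:
  fixes \<phi> :: "real \<Rightarrow> real"
  assumes nonneg: "\<And>s. 0 \<le> \<phi> s" and step: "\<And>s d. \<bar>cos d\<bar> * \<phi> s \<le> \<phi> (s + d)"
  shows "\<phi> s = \<phi> t"
proof -
  have iter: "\<bar>cos d\<bar> ^ n * \<phi> s \<le> \<phi> (s + real n * d)" for n s d
  proof (induction n)
    case (Suc n)
    have "\<bar>cos d\<bar> ^ Suc n * \<phi> s \<le> \<bar>cos d\<bar> * \<phi> (s + real n * d)"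
      using Suc by (simp add: mult.assoc mult_left_mono)
    also have "\<dots> \<le> \<phi> (s + real (Suc n) * d)"
      using step[of d "s + real n * d"] by (simp add: algebra_simps)
    finally show ?case .
  qed simp
  have "\<phi> s \<le> \<phi> (s + d)" for s d
  proof (rule LIMSEQ_le_const2)
    have "(\<lambda>n. (1 - (d\<^sup>2 / 2) / real n) * \<phi> s) \<longlonglongrightarrow> (1 - 0) * \<phi> s"
      by (intro tendsto_intros lim_const_over_n)
    then show "(\<lambda>n. (1 - (d\<^sup>2 / 2) / real n) * \<phi> s) \<longlonglongrightarrow> \<phi> s"
      by simp
    obtain N where N: "d\<^sup>2 / 2 \<le> real N"
      using real_arch_simple by blast
    have "(1 - (d\<^sup>2 / 2) / real n) * \<phi> s \<le> \<phi> (s + d)" if n: "Suc N \<le> n" for n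
    proof -
      define x where "x = d\<^sup>2 / 2 / (real n)\<^sup>2"
      have "1 \<le> real n" "d\<^sup>2 / 2 \<le> real n" using N n by auto
      then have "d\<^sup>2 / 2 \<le> (real n)\<^sup>2"
        using self_le_power[of "real n" 2] by linarith
      then have x: "x \<le> 1" using n by (simp add: x_def divide_le_eq)
      have "(sin (d / real n / 2))\<^sup>2 \<le> (d / real n / 2)\<^sup>2"
        using abs_sin_x_le_abs_x by (simp only: abs_le_square_iff)
      then have "1 - x \<le> cos (d / real n)"
        using cos_double_sin[of "d / real n / 2"] by (simp add: x_def power_divide)
      then have c: "1 - x \<le> \<bar>cos (d / real n)\<bar>" by linarith
      have "1 - (d\<^sup>2 / 2) / real n = 1 + of_nat n * (- x)"
        using n by (simp add: x_def power2_eq_square)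
      also have "\<dots> \<le> (1 + - x) ^ n"
        using x by (intro Bernoulli_inequality) simp
      also have "\<dots> \<le> \<bar>cos (d / real n)\<bar> ^ n"
        using c x by (intro power_mono) auto
      finally have "(1 - (d\<^sup>2 / 2) / real n) * \<phi> s \<le> \<bar>cos (d / real n)\<bar> ^ n * \<phi> s"
        using nonneg by (intro mult_right_mono)
      also have "\<dots> \<le> \<phi> (s + d)"
        using iter[of "d / real n" n s] n by simp
      finally show ?thesis .
    qed
    then show "\<exists>N. \<forall>n\<ge>N. (1 - (d\<^sup>2 / 2) / real n) * \<phi> s \<le> \<phi> (s + d)" by blast
  qed
  from this[of s "t - s"] this[of t "s - t"] show ?thesis by simp
qed

context bj_symmetric
begin

sublocale polarity G
proof (rule polarity.intro)
  show "linear (G x)" for x by (rule G_linear)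
  show "G (c *\<^sub>R x) y = c * G x y" for c x y by (rule G_scale)
  show "x \<noteq> 0 \<Longrightarrow> 0 < G x x" for x by (simp add: G_self)
  show "G x y = 0 \<Longrightarrow> G y x = 0" for x y
    using G_eq_0_imp_bj bj_sym bj_imp_G_eq_0 by blast
qed

text \<open>The curve \<open>z\<close> is an ellipse of the expected quadratic form and
  \<open>w\<close> its derivative. The ratio makes \<open>z s\<close> orthogonal to
  \<open>w s\<close>, and the addition formulas express \<open>z (s + d)\<close> through both, so
  the norm is constant along \<open>z\<close>.\<close>

lemma norm_on_orthogonal_pair:
  assumes orth: "G e1 e2 = 0" and "0 < c"
    and ratio: "\<And>t. G (e1 + t *\<^sub>R e2) e2 = c * t * G (e1 + t *\<^sub>R e2) e1"
  shows "(norm (e1 + t *\<^sub>R e2))\<^sup>2 = (norm e1)\<^sup>2 * (1 + c * t\<^sup>2)"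
proof -
  define z where "z s = cos s *\<^sub>R e1 + (sin s / sqrt c) *\<^sub>R e2" for s
  define w where "w s = (cos s / sqrt c) *\<^sub>R e2 - sin s *\<^sub>R e1" for s
  have "G (z s) (w s) = 0" for s
  proof (cases "cos s = 0")
    case True
    then show ?thesis using orth eq_0_sym[of e1 e2] linear_neg[OF lin]
      by (simp add: z_def w_def scale lin_simps)
  next
    case False
    define r where "r = sin s / sqrt c / cos s"
    have z: "z s = cos s *\<^sub>R (e1 + r *\<^sub>R e2)"
      using False by (simp add: z_def r_def scaleR_add_right)
    have "cos s / sqrt c * (c * r) = sin s"
      using False \<open>0 < c\<close> by (simp add: r_def)
    then have "cos s / sqrt c * G (e1 + r *\<^sub>R e2) e2 = sin s * G (e1 + r *\<^sub>R e2) e1"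
      unfolding ratio by (metis mult.assoc)
    then have "G (e1 + r *\<^sub>R e2) (w s) = 0" by (simp add: w_def lin_simps)
    then show ?thesis by (simp add: z scale)
  qed
  then have bj: "bj_orthogonal (z s) (w s)" for s
    by (rule G_eq_0_imp_bj)
  have const: "norm (z s) = norm (z t)" for s t
  proof (rule cos_lower_bound_imp_constant[where \<phi> = "\<lambda>s. norm (z s)"])
    show "\<bar>cos d\<bar> * norm (z s) \<le> norm (z (s + d))" for s d
    proof -
      have "z (s + d) = cos d *\<^sub>R z s + sin d *\<^sub>R w s"
        by (simp add: z_def w_def cos_add sin_add algebra_simps add_divide_distrib)
      then show ?thesis using bj_orthogonal_norm_le[OF bj] by simp
    qed
  qed simp
  have pos: "0 < 1 + c * t\<^sup>2" using \<open>0 < c\<close> by (simp add: add_pos_nonneg)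
  \<comment> \<open>The parameter at which the ellipse meets the ray through
    \<open>e1 + t *\<^sub>R e2\<close>.\<close>
  let ?a = "arctan (sqrt c * t)"
  have "z ?a = (1 / sqrt (1 + c * t\<^sup>2)) *\<^sub>R (e1 + t *\<^sub>R e2)"
    using \<open>0 < c\<close> by (simp add: z_def cos_arctan sin_arctan power_mult_distrib scaleR_add_right)
  moreover have "norm (z ?a) = norm e1"
    using const[of ?a 0] by (simp add: z_def)
  ultimately have "norm (e1 + t *\<^sub>R e2) / sqrt (1 + c * t\<^sup>2) = norm e1"
    using pos by simp
  then have "norm (e1 + t *\<^sub>R e2) = norm e1 * sqrt (1 + c * t\<^sup>2)"
    using pos by (simp add: divide_eq_eq)
  then show ?thesis using pos by (simp add: power_mult_distrib)
qed

text \<open>Write \<open>y\<close> as a multiple of \<open>?z = x + e\<close> with \<open>e\<close>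
  orthogonal to \<open>x\<close>. Computing \<open>G ?z ?z\<close> once by the coordinate ratio and
  once as a squared norm gives \<open>G ?z x = G x x\<close>, which is also
  \<open>G x ?z\<close>.\<close>

lemma G_sym: "G x y = G y x"
proof (cases "x = 0 \<or> G x y = 0")
  case True
  then show ?thesis using eq_0_sym[of x y] scale[of 0 0 y] by (auto simp: lin_simps)
next
  case False
  then have x: "x \<noteq> 0" "G x x \<noteq> 0" using pos[of x] by auto
  define a where "a = G x y / G x x"
  have a: "a \<noteq> 0" using False x by (simp add: a_def)
  define e where "e = (1 / a) *\<^sub>R y - x"
  have y: "y = a *\<^sub>R (x + 1 *\<^sub>R e)" using a by (simp add: e_def)
  have orth: "G x e = 0" using False x by (simp add: e_def a_def lin_simps)
  show ?thesis
  proof (cases "e = 0")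
    case True
    then show ?thesis by (simp add: y scale lin_simps)
  next
    case False
    obtain k where k: "k \<noteq> 0" "G x k = 0" "G e k = 0"
      using dim_gt_2_common_zero[OF G_linear G_linear dim_gt_2] by blast
    obtain c where c: "0 < c" "\<And>t. G (x + t *\<^sub>R e) e = c * t * G (x + t *\<^sub>R e) x"
      using coordinate_ratio[OF x(1) False k(1) orth k(2,3)] by blast
    let ?z = "x + 1 *\<^sub>R e"
    have "G ?z ?z = G ?z x * (1 + c)"
      using c(2)[of 1] lin_simps(1)[of ?z x e] by (simp add: algebra_simps)
    moreover have "G ?z ?z = G x x * (1 + c)"
      using norm_on_orthogonal_pair[OF orth c, of 1] by (simp add: G_self)
    ultimately have "G ?z x = G x x" using c(1) by simp
    then show ?thesis using orth by (simp add: y scale lin_simps)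
  qed
qed

lemma norm_induced: "induced_by_inner_product (norm :: 'a \<Rightarrow> real)"
  unfolding induced_by_inner_product_def is_inner_product_def bilinear_def
proof (intro exI[of _ G] conjI allI impI)
  show "linear (\<lambda>x. G x y)" for y
    using G_linear[of y] by (simp add: G_sym[of _ y])
  show "linear (\<lambda>y. G x y)" for x by (rule G_linear)
  show "G x y = G y x" for x y by (rule G_sym)
  show "0 < G x x" if "x \<noteq> 0" for x by (rule pos[OF that])
  show "norm x = sqrt (G x x)" for x by (simp add: G_self)
qed

end

section \<open>Norm attainment\<close>

text \<open>If f supports the unit vector x and kills y, then \<open>z \<mapsto> f z x\<close> attains its norm at x and its minimum norm at y.\<close>

lemma bj_orthogonal_sym_if_attainment:
  fixes x y :: "'a::real_normed_vector"
  assumes B: "finite (B :: 'a set)" "span B = UNIV"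
    and T: "\<And>T :: 'a \<Rightarrow>\<^sub>L 'a.
      norm_attainment_set T = sphere 0 1 \<and> min_norm_attainment_set T = sphere 0 1 \<or>
      bj_orthogonal_sets (min_norm_attainment_set T) (norm_attainment_set T)"
    and xy: "bj_orthogonal x y"
  shows "bj_orthogonal y x"
proof (cases "x = 0 \<or> y = 0")
  case True
  then show ?thesis by (auto simp: bj_orthogonal_def)
next
  case False
  define u where "u = (1 / norm x) *\<^sub>R x"
  define v where "v = (1 / norm y) *\<^sub>R y"
  have uv: "norm u = 1" "norm v = 1" using False by (auto simp: u_def v_def)
  obtain f where f: "support x f" "f y = 0"
    using bj_orthogonal_imp_support[OF xy B] by blast
  note linf = support_linear[OF f(1)]
  have fu: "f u = 1" "f v = 0"
    using False f support_self[OF f(1)] by (auto simp: u_def v_def linear_scale[OF linf])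
  have abs_f: "\<bar>f z\<bar> \<le> norm z" for z
    using support_le[OF f(1), of z] support_le[OF f(1), of "- z"] linear_neg[OF linf, of z] by simp
  have "bounded_linear (\<lambda>z. f z *\<^sub>R u)"
    using abs_f uv by (intro bounded_linear_intro[of _ 1])
      (auto simp: linear_add[OF linf] linear_scale[OF linf] algebra_simps)
  then have T_apply: "blinfun_apply (Blinfun (\<lambda>z. f z *\<^sub>R u)) z = f z *\<^sub>R u" for z
    by (simp add: bounded_linear_Blinfun_apply)
  define T where "T = Blinfun (\<lambda>z. f z *\<^sub>R u)"
  have nT: "norm (blinfun_apply T z) = \<bar>f z\<bar>" for z
    using uv by (simp add: T_def T_apply)
  have "norm T = 1"
  proof (rule antisym)
    show "norm T \<le> 1" using abs_f by (intro norm_blinfun_bound) (auto simp: nT)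
    show "1 \<le> norm T" using norm_blinfun[of T u] by (simp add: nT uv fu)
  qed
  then have u: "u \<in> norm_attainment_set T" and nv: "v \<notin> norm_attainment_set T"
    using uv fu by (auto simp: norm_attainment_set_def nT)
  have "min_norm T = 0"
    unfolding min_norm_def
  proof (rule cInf_eq_minimum)
    show "0 \<in> (\<lambda>z. norm (blinfun_apply T z)) ` sphere 0 1"
      using uv fu by (intro image_eqI[of _ _ v]) (auto simp: nT)
  qed auto
  then have v: "v \<in> min_norm_attainment_set T"
    using uv fu by (auto simp: min_norm_attainment_set_def nT)
  \<comment> \<open>The first alternative fails for \<open>T\<close> because \<open>v\<close> is a
    unit vector outside its norm attainment set.\<close>
  have "bj_orthogonal v u"
    using T[of T] u v nv uv by (auto simp: bj_orthogonal_sets_def)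
  then have "bj_orthogonal v (r *\<^sub>R u)" for r
    by (simp add: bj_orthogonal_def)
  note vu = this[of "norm x / norm y"]
  have "norm y \<le> norm (y + c *\<^sub>R x)" for c
  proof -
    have "norm y \<le> norm (norm y *\<^sub>R v + (c * norm y) *\<^sub>R ((norm x / norm y) *\<^sub>R u))"
      using bj_orthogonal_norm_le[OF vu, of "norm y" "c * norm y"] uv by simp
    then show ?thesis using False by (simp add: u_def v_def)
  qed
  then show ?thesis by (simp add: bj_orthogonal_def)
qed

section \<open>Extremal vectors of operators on a Euclidean space\<close>

lemma psd_form_null_vector:
  fixes C :: "'a::real_vector \<Rightarrow> 'a \<Rightarrow> real"
  assumes bil: "bilinear C" and sym: "\<And>x y. C x y = C y x"
    and psd: "\<And>z. 0 \<le> C z z" and null: "C x x = 0"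
  shows "C x w = 0"
proof (rule ccontr)
  assume nz: "C x w \<noteq> 0"
  \<comment> \<open>With \<open>C x x = 0\<close> the form is affine in \<open>t\<close> along
    \<open>w + t *\<^sub>R x\<close>; this \<open>t\<close> gives it the value -1.\<close>
  define t where "t = - (C w w + 1) / (2 * C x w)"
  have "C (w + t *\<^sub>R x) (w + t *\<^sub>R x) = C w w + 2 * t * C x w"
    using null sym[of w x]
    by (simp add: bilinear_ladd[OF bil] bilinear_radd[OF bil] bilinear_lmul[OF bil]
        bilinear_rmul[OF bil])
  also have "\<dots> = - 1" using nz by (simp add: t_def field_simps)
  finally show False using psd[of "w + t *\<^sub>R x"] by simp
qed

locale inner_product_norm =
  fixes ip :: "'a::real_normed_vector \<Rightarrow> 'a \<Rightarrow> real"
  assumes bil: "bilinear ip" and sym: "ip x y = ip y x" and norm_sq: "(norm x)\<^sup>2 = ip x x"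
begin

lemmas bil_simps = bilinear_ladd[OF bil] bilinear_radd[OF bil] bilinear_lmul[OF bil] bilinear_rmul[OF bil]

lemma ip_eq_0_imp_bj:
  assumes "ip x y = 0"
  shows "bj_orthogonal x y"
  unfolding bj_orthogonal_def
proof
  fix c
  have "(norm (x + c *\<^sub>R y))\<^sup>2 = (norm x)\<^sup>2 + c\<^sup>2 * (norm y)\<^sup>2"
    using assms sym[of y x] unfolding norm_sq by (simp add: bil_simps power2_eq_square)
  then have "(norm x)\<^sup>2 \<le> (norm (x + c *\<^sub>R y))\<^sup>2" by simp
  then show "norm x \<le> norm (x + c *\<^sub>R y)" by (rule power2_le_imp_le) simp
qed

text \<open>A unit vector at which \<open>norm (T z)\<close> is extremal is an eigenvector of \<open>T\<^sup>* T\<close>; the factor s is 1 at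
  a maximum and -1 at a minimum.\<close>

lemma extremal_eigenvector:
  fixes T :: "'a \<Rightarrow>\<^sub>L 'a"
  assumes ext: "\<And>z. s * (norm (blinfun_apply T z))\<^sup>2 \<le> s * (M * norm z)\<^sup>2"
    and x: "norm (blinfun_apply T x) = M * norm x" and s: "s \<noteq> 0"
  shows "ip (blinfun_apply T x) (blinfun_apply T w) = M\<^sup>2 * ip x w"
proof -
  let ?T = "blinfun_apply T"
  \<comment> \<open>The form of \<open>s\<close> times the difference of \<open>M\<^sup>2\<close>
    and \<open>T\<^sup>* T\<close>: semidefinite by \<open>ext\<close>, with \<open>x\<close> as a
    null vector.\<close>
  define C where "C z w = s * (M\<^sup>2 * ip z w - ip (?T z) (?T w))" for z w
  have "C x w = 0"
  proof (rule psd_form_null_vector[of C])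
    show "bilinear C"
      unfolding bilinear_def C_def
      by (auto intro!: linearI simp: blinfun.add_right blinfun.scaleR_right bil_simps algebra_simps)
    show "C z w = C w z" for z w
      using sym[of z w] sym[of "?T z" "?T w"] by (simp add: C_def)
    have C_sq: "C z z = s * (M * norm z)\<^sup>2 - s * (norm (?T z))\<^sup>2" for z
      by (simp add: C_def norm_sq power_mult_distrib right_diff_distrib)
    show "0 \<le> C z z" for z
      unfolding C_sq using ext[of z] by simp
    show "C x x = 0"
      unfolding C_sq x by simp
  qed
  then show ?thesis using s by (simp add: C_def)
qed

text \<open>If the minimum equals the norm, every unit vector attains both. Otherwise the two sets
  consist of eigenvectors of \<open>T\<^sup>* T\<close> for distinct eigenvalues, which are
  orthogonal.\<close>

lemma attainment_dichotomy:
  fixes T :: "'a \<Rightarrow>\<^sub>L 'a"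
  shows "(norm_attainment_set T = sphere 0 1 \<and> min_norm_attainment_set T = sphere 0 1) \<or>
      (bj_orthogonal_sets (norm_attainment_set T) (min_norm_attainment_set T) \<and>
       bj_orthogonal_sets (min_norm_attainment_set T) (norm_attainment_set T))"
proof -
  let ?T = "blinfun_apply T" and ?m = "min_norm T"
  have bdd: "bdd_below ((\<lambda>z. norm (?T z)) ` sphere 0 1)"
    by (rule bdd_belowI2[of _ 0]) simp
  have lower: "?m \<le> norm (?T z)" if "norm z = 1" for z
    unfolding min_norm_def using that by (intro cINF_lower[OF bdd]) simp
  have upper: "norm (?T z) \<le> norm T" if "norm z = 1" for z
    using norm_blinfun[of T z] that by simp
  show ?thesis
  proof (cases "?m = norm T")
    case True
    then have "norm (?T z) = norm T" if "norm z = 1" for z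
      using lower[OF that] upper[OF that] by simp
    with True show ?thesis
      by (auto simp: norm_attainment_set_def min_norm_attainment_set_def)
  next
    case False
    have "ip a b = 0" if a: "a \<in> norm_attainment_set T" and b: "b \<in> min_norm_attainment_set T" for a b
    proof -
      have a1: "norm a = 1" "norm (?T a) = norm T"
        using a by (auto simp: norm_attainment_set_def)
      have b1: "norm b = 1" "norm (?T b) = ?m"
        using b by (auto simp: min_norm_attainment_set_def)
      have m0: "0 \<le> ?m" using b1 norm_ge_zero by metis
      have scaled: "?m * norm z \<le> norm (?T z)" for z
      proof (cases "z = 0")
        case False
        then have "?m \<le> norm (?T ((1 / norm z) *\<^sub>R z))"
          by (intro lower) simp
        then show ?thesis using False by (simp add: blinfun.scaleR_right field_simps)
      qed simp
      have "ip (?T a) (?T b) = (norm T)\<^sup>2 * ip a b"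
        using a1 norm_blinfun[of T] by (intro extremal_eigenvector[of 1]) (auto intro: power_mono)
      moreover have "ip (?T b) (?T a) = ?m\<^sup>2 * ip b a"
        using b1 scaled m0 by (intro extremal_eigenvector[of "-1"]) (auto intro!: power_mono)
      ultimately have "(norm T)\<^sup>2 * ip a b = ?m\<^sup>2 * ip a b"
        using sym by metis
      moreover have "(norm T)\<^sup>2 \<noteq> ?m\<^sup>2"
        using False m0 by (simp add: power2_eq_iff_nonneg)
      ultimately show ?thesis by simp
    qed
    then show ?thesis
      using ip_eq_0_imp_bj sym unfolding bj_orthogonal_sets_def by metis
  qed
qed

end

theorem theorem3p6:
  assumes "finite_dimensional TYPE('a::banach)"
    and "dim (UNIV :: 'a set) > 2"
  shows "induced_by_inner_product (norm :: 'a \<Rightarrow> real) \<longleftrightarrow>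
    (\<forall>T :: 'a \<Rightarrow>\<^sub>L 'a.
      (norm_attainment_set T = sphere 0 1 \<and> min_norm_attainment_set T = sphere 0 1) \<or>
      (bj_orthogonal_sets (norm_attainment_set T) (min_norm_attainment_set T) \<and>
       bj_orthogonal_sets (min_norm_attainment_set T) (norm_attainment_set T)))"
    (is "_ \<longleftrightarrow> ?R")
proof
  assume "induced_by_inner_product (norm :: 'a \<Rightarrow> real)"
  then obtain ip :: "'a \<Rightarrow> 'a \<Rightarrow> real" where ip: "is_inner_product ip" "\<And>x. norm x = sqrt (ip x x)"
    unfolding induced_by_inner_product_def by blast
  \<comment> \<open>The real \<open>sqrt\<close> is negative on negative numbers, so a nonnegative
    norm forces a nonnegative argument.\<close>
  have "0 \<le> ip x x" for x
    using ip(2)[of x] norm_ge_zero[of x] by simp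
  then interpret inner_product_norm ip
    using ip by unfold_locales (auto simp: is_inner_product_def)
  show ?R using attainment_dichotomy by blast
next
  assume R: ?R
  obtain B :: "'a set" where B: "finite B" "span B = UNIV"
    using assms(1) unfolding finite_dimensional_def by blast
  interpret bj_symmetric B
  proof
    show "bj_orthogonal y x" if "bj_orthogonal x y" for x y :: 'a
      using bj_orthogonal_sym_if_attainment[OF B _ that] R by blast
  qed (use B assms(2) in auto)
  show "induced_by_inner_product (norm :: 'a \<Rightarrow> real)" by (rule norm_induced)
qed

end
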